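(* Let $p$ be an odd prime and $n$ an integer with $6\le 2n\le p-1$. Then $$A_{2n}\equiv\frac{p^2}{2}\mathcal{C}(2n)-p\,\mathcal{B}_{2n}-\frac{p^3}{6}\,\mathcal{T}(2n)-\frac{16n^2-12n+5}{24}\,p^3\,\mathcal{B}_{2n-2}\pmod{p^4}.$$
   Context: $A_k:=\sum_{1\le i_1<\dots<i_k\le p-1}i_1\cdots i_k$ (the unsigned Stirling number of the first kind counting permutations of $p$ letters with $p-k$ cycles). $B_n$ is the $n$-th Bernoulli number and $\mathcal{B}_n:=B_n/n$. For even $n\ge4$, $\mathcal{C}(n):=\sum_{i=2}^{n-2}\mathcal{B}_i\mathcal{B}_{n-i}$ and $\mathcal{T}(n):=\sum_{i=2}^{n-4}\mathcal{B}_i\mathcal{C}(n-i)$ (sum of products of three divided Bernoulli numbers with indices $\ge2$ summing to $n$, over ordered triples). Congruences are in $\mathbb{Q}_p$: difference in $p^4\mathbb{Z}_p$. *)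

theory Defs
  imports
    "HOL-Computational_Algebra.Formal_Power_Series"
    "HOL-Computational_Algebra.Primes"
    "HOL-Combinatorics.Stirling"
begin

definition A_sym :: "nat \<Rightarrow> nat \<Rightarrow> nat" where
  "A_sym p k = (\<Sum>I | I \<subseteq> {1..p - 1} \<and> card I = k. \<Prod>I)"

text \<open>The Bernoulli numbers are those of \<open>t / (exp t - 1)\<close>, so that \<open>bernoulli 1 = -1/2\<close>.
  Indices in the sums below start at 2, where all conventions agree.\<close>

definition bernoulli :: "nat \<Rightarrow> rat" where
  "bernoulli n = fact n * fps_nth (fps_X / (fps_exp 1 - 1)) n"

definition div_bernoulli :: "nat \<Rightarrow> rat" where
  "div_bernoulli n = bernoulli n / of_nat n"

text \<open>The following two sums are intended for even \<open>n \<ge> 4\<close>, where the natural-number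
  subtractions do not truncate. For \<open>n = 4\<close> the sum \<open>T_sum n\<close> is empty, and for odd \<open>i\<close> the
  factor \<open>div_bernoulli i\<close> vanishes, so only even arguments \<open>n - i \<ge> 4\<close> of \<open>C_sum\<close> matter.\<close>

definition C_sum :: "nat \<Rightarrow> rat" where
  "C_sum n = (\<Sum>i = 2..n - 2. div_bernoulli i * div_bernoulli (n - i))"

definition T_sum :: "nat \<Rightarrow> rat" where
  "T_sum n = (\<Sum>i = 2..n - 4. div_bernoulli i * C_sum (n - i))"

text \<open>For rational numbers, membership in \<open>p\<^sup>k \<int>\<^sub>p\<close> only involves the rational \<open>p\<close>-adic
  integers \<open>\<rat> \<inter> \<int>\<^sub>p\<close>, which are the fractions whose denominator is prime to \<open>p\<close>
  (the case \<open>b = 0\<close> is excluded by \<open>\<not> int p dvd b\<close>).\<close>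

definition padic_integers_rat :: "nat \<Rightarrow> rat set" where
  "padic_integers_rat p = {of_int a / of_int b | a b. \<not> int p dvd b}"

definition padic_cong :: "nat \<Rightarrow> nat \<Rightarrow> rat \<Rightarrow> rat \<Rightarrow> bool" where
  "padic_cong p k x y \<longleftrightarrow> (\<exists>z \<in> padic_integers_rat p. x - y = of_nat p ^ k * z)"

text \<open>The next facts relate these definitions to the Stirling numbers, to the usual
  recurrence of the Bernoulli numbers and to the \<open>p\<close>-adic valuation.\<close>

lemma A_sym_eq_stirling:
  assumes "p > 0" "k \<le> p"
  shows "A_sym p k = stirling p (p - k)"
proof -
  define e where "e n k = (\<Sum>I | I \<subseteq> {1..n} \<and> card I = k. \<Prod>I)" for n k :: nat
  have e0: "e n 0 = 1" for n
  proof -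
    have "{I. I \<subseteq> {1..n} \<and> card I = 0} = {{}}"
      by (auto dest: finite_subset)
    thus ?thesis by (simp add: e_def)
  qed
  have e_big: "e n k = 0" if "k > n" for n k
  proof -
    have "card I \<le> n" if "I \<subseteq> {1..n}" for I :: "nat set"
      using card_mono[OF _ that] by simp
    hence "\<not> (I \<subseteq> {1..n} \<and> card I = k)" for I :: "nat set"
      using that by (metis not_le)
    hence "{I. I \<subseteq> {1..n} \<and> card I = k} = {}"
      by blast
    thus ?thesis by (simp only: e_def sum.empty)
  qed
  have eSuc: "e (Suc n) (Suc k) = e n (Suc k) + Suc n * e n k" for n k
  proof -
    let ?P = "{I. I \<subseteq> {1..n} \<and> card I = Suc k}" and ?Q = "{I. I \<subseteq> {1..n} \<and> card I = k}"
    have fin: "finite I" and notin: "Suc n \<notin> I" if "I \<subseteq> {1..n}" for I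
      using that finite_subset by auto
    have eq: "{I. I \<subseteq> {1..Suc n} \<and> card I = Suc k} = ?P \<union> insert (Suc n) ` ?Q"
    proof (intro equalityI subsetI)
      fix I assume I: "I \<in> {I. I \<subseteq> {1..Suc n} \<and> card I = Suc k}"
      show "I \<in> ?P \<union> insert (Suc n) ` ?Q"
      proof (cases "Suc n \<in> I")
        case True
        hence "I = insert (Suc n) (I - {Suc n})" by auto
        moreover have "I - {Suc n} \<in> ?Q" using I True by (auto simp: le_Suc_eq)
        ultimately show ?thesis by blast
      qed (use I in \<open>auto simp: le_Suc_eq\<close>)
    next
      fix I assume "I \<in> ?P \<union> insert (Suc n) ` ?Q"
      thus "I \<in> {I. I \<subseteq> {1..Suc n} \<and> card I = Suc k}"
        using fin notin by (fastforce simp: card_insert_if)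
    qed
    have inj: "inj_on (insert (Suc n)) ?Q"
      by (rule inj_onI) (use notin in \<open>metis (no_types, lifting) insert_ident mem_Collect_eq\<close>)
    have fins: "finite ?P" "finite ?Q"
      by (rule finite_subset[of _ "Pow {1..n}"]; auto)+
    have "e (Suc n) (Suc k) = (\<Sum>I\<in>?P. \<Prod>I) + (\<Sum>I\<in>insert (Suc n) ` ?Q. \<Prod>I)"
      unfolding e_def eq using fins notin by (intro sum.union_disjoint) auto
    also have "(\<Sum>I\<in>insert (Suc n) ` ?Q. \<Prod>I) = (\<Sum>I\<in>?Q. Suc n * \<Prod>I)"
      unfolding sum.reindex[OF inj] o_def
      using fin notin by (intro sum.cong) auto
    finally show ?thesis by (simp add: e_def sum_distrib_left)
  qed
  have main: "e n k = stirling (Suc n) (Suc n - k)" if "k \<le> Suc n" for n k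
    using that
  proof (induction n arbitrary: k)
    case 0
    thus ?case by (cases k) (auto simp: e0 e_big)
  next
    case (Suc n)
    show ?case
    proof (cases k)
      case 0
      thus ?thesis by (simp add: e0)
    next
      case (Suc j)
      show ?thesis
      proof (cases "j = Suc n")
        case True
        thus ?thesis using Suc by (simp add: e_big)
      next
        case False
        hence "j \<le> n" using Suc Suc.prems by simp
        thus ?thesis using Suc Suc.IH[of j] Suc.IH[of "Suc j"] eSuc[of n j]
          by (simp add: Suc_diff_le)
      qed
    qed
  qed
  show ?thesis using main[of k "p - 1"] assms by (simp add: A_sym_def e_def)
qed

lemma bernoulli_recurrence:
  "(\<Sum>k\<le>n. of_nat (Suc n choose k) * bernoulli k) = (if n = 0 then 1 else 0)"
proof -
  let ?E = "fps_exp 1 - 1 :: rat fps"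
  have nth1: "fps_nth ?E 1 \<noteq> 0"
    by simp
  hence ne: "?E \<noteq> 0"
    by (metis fps_zero_nth)
  have sub: "subdegree ?E = 1"
    using nth1 by (rule subdegreeI) simp
  have "?E dvd fps_X"
    using ne sub by (subst fps_dvd_iff) auto
  hence eq: "fps_X / ?E * ?E = fps_X"
    by simp
  have "(\<Sum>k\<le>n. of_nat (Suc n choose k) * bernoulli k)
        = fact (Suc n) * (\<Sum>k\<le>n. fps_nth (fps_X / ?E) k * fps_nth ?E (Suc n - k))"
    unfolding sum_distrib_left
  proof (rule sum.cong[OF refl])
    fix k assume k: "k \<in> {..n}"
    have "(of_nat (Suc n choose k) :: rat) = fact (Suc n) / (fact k * fact (Suc n - k))"
      using k by (intro binomial_fact) auto
    thus "of_nat (Suc n choose k) * bernoulli k =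
          fact (Suc n) * (fps_nth (fps_X / ?E) k * fps_nth ?E (Suc n - k))"
      using k unfolding bernoulli_def by (simp add: Suc_diff_le del: fact_Suc)
  qed
  also have "(\<Sum>k\<le>n. fps_nth (fps_X / ?E) k * fps_nth ?E (Suc n - k))
             = fps_nth (fps_X / ?E * ?E) (Suc n)"
    unfolding fps_mult_nth by (simp add: atMost_atLeast0)
  also have "fact (Suc n) * \<dots> = (if n = 0 then 1 else 0)"
    unfolding eq by simp
  finally show ?thesis .
qed

lemma padic_cong_iff_multiplicity:
  assumes "prime p" "x - y = of_int a / of_int b" "a \<noteq> 0" "b \<noteq> 0"
  shows "padic_cong p k x y \<longleftrightarrow> multiplicity (int p) a \<ge> k + multiplicity (int p) b"
proof -
  have p: "prime (int p)" using assms(1) by simp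
  have p0: "of_nat p \<noteq> (0 :: rat)" using assms(1) by (auto simp: prime_gt_0_nat)
  note nd = prime_elem_multiplicity_mult_distrib[OF prime_imp_prime_elem[OF p]]
  show ?thesis
  proof
    assume "padic_cong p k x y"
    then obtain c d where cd: "\<not> int p dvd d" "of_int a / of_int b = of_nat p ^ k * (of_int c / of_int d :: rat)"
      unfolding padic_cong_def padic_integers_rat_def assms(2) by blast
    have d: "d \<noteq> 0" using cd(1) by auto
    have "of_int (a * d) = (of_int (int p ^ k * c * b) :: rat)"
      using cd(2) d assms(4) by (simp add: field_simps)
    hence eq: "a * d = int p ^ k * c * b" by (simp only: of_int_eq_iff)
    have c: "c \<noteq> 0" using eq d assms(3) by auto
    have "multiplicity (int p) (a * d) = multiplicity (int p) a"
      using nd d assms(3) cd(1) by (simp add: not_dvd_imp_multiplicity_0)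
    moreover have "multiplicity (int p) (int p ^ k * c * b) =
        k + multiplicity (int p) c + multiplicity (int p) b"
      using nd c assms(4) p by (simp add: prime_elem_multiplicity_power_distrib)
    ultimately show "multiplicity (int p) a \<ge> k + multiplicity (int p) b"
      using eq by simp
  next
    assume ge: "multiplicity (int p) a \<ge> k + multiplicity (int p) b"
    have npu: "\<not> is_unit (int p)" using p by (auto dest: not_prime_unit)
    obtain d where d: "b = int p ^ multiplicity (int p) b * d" "\<not> int p dvd d"
      using multiplicity_decompose'[OF assms(4) npu] by metis
    have "int p ^ (k + multiplicity (int p) b) dvd a"
      using ge by (rule multiplicity_dvd')
    then obtain c where c: "a = int p ^ (k + multiplicity (int p) b) * c" ..
    define m where "m = multiplicity (int p) b"
    have "of_int a / of_int b = of_nat p ^ k * (of_int c / of_int d :: rat)"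
      using p0 by (subst c, subst d(1), fold m_def) (simp add: power_add)
    thus "padic_cong p k x y"
      unfolding padic_cong_def padic_integers_rat_def assms(2) using d(2) by blast
  qed
qed

end

theory Submission
  imports Defs
begin

text \<open>The numbers \<open>A\<^sub>k\<close> are the coefficients of \<open>(1 + X)(1 + 2X) \<dots> (1 + (p-1)X) = exp L\<close>, where
  \<open>L\<^sub>m = (-1)\<^sup>m\<^sup>+\<^sup>1 (1\<^sup>m + \<dots> + (p-1)\<^sup>m) / m\<close>. Faulhaber's formula expands the power sums in
  Bernoulli numbers and gives \<open>L = p U + p\<^sup>2 V + p\<^sup>3 W + p\<^sup>4 Z\<close>. In degrees at most \<open>p - 1\<close> all four
  series are \<open>p\<close>-integral, except for \<open>U\<close> in degree \<open>p - 1\<close>, where \<open>B\<^sub>p\<^sub>-\<^sub>1\<close> has denominator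
  divisible by \<open>p\<close>. This coefficient enters only through the linear term of \<open>exp L\<close>, because \<open>L\<close> has no
  constant term. So modulo \<open>p\<^sup>4\<close> it suffices to read off the coefficient of \<open>X\<^sup>2\<^sup>n\<close> in
  \<open>L + L\<^sup>2/2 + L\<^sup>3/6\<close>, where the vanishing of the odd Bernoulli numbers removes most terms.\<close>

section \<open>Rational \<open>p\<close>-adic integers\<close>

lemma padic_of_int [simp, intro]: "prime p \<Longrightarrow> of_int a \<in> padic_integers_rat p"
  unfolding padic_integers_rat_def
  by (rule CollectI, rule exI[of _ a], rule exI[of _ 1]) (auto simp: prime_nat_iff)

lemma padic_of_nat [simp, intro]: "prime p \<Longrightarrow> of_nat a \<in> padic_integers_rat p"
  using padic_of_int[of p "int a"] by simp

lemma padic_0 [simp, intro]: "prime p \<Longrightarrow> 0 \<in> padic_integers_rat p"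
  and padic_1 [simp, intro]: "prime p \<Longrightarrow> 1 \<in> padic_integers_rat p"
  using padic_of_int[of p 0] padic_of_int[of p 1] by simp_all

lemma padic_add [intro]:
  assumes "prime p" "x \<in> padic_integers_rat p" "y \<in> padic_integers_rat p"
  shows "x + y \<in> padic_integers_rat p"
proof -
  obtain a b c d where ab: "x = of_int a / of_int b" "\<not> int p dvd b"
    and cd: "y = of_int c / of_int d" "\<not> int p dvd d"
    using assms(2,3) unfolding padic_integers_rat_def by blast
  have "b \<noteq> 0" "d \<noteq> 0" using ab cd by auto
  hence "x + y = of_int (a * d + c * b) / of_int (b * d)"
    unfolding ab cd by (simp add: field_simps)
  moreover have "\<not> int p dvd b * d"
    using ab cd assms(1) by (simp add: prime_dvd_mult_iff)
  ultimately show ?thesis unfolding padic_integers_rat_def by blast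
qed

lemma padic_mult [intro]:
  assumes "prime p" "x \<in> padic_integers_rat p" "y \<in> padic_integers_rat p"
  shows "x * y \<in> padic_integers_rat p"
proof -
  obtain a b c d where ab: "x = of_int a / of_int b" "\<not> int p dvd b"
    and cd: "y = of_int c / of_int d" "\<not> int p dvd d"
    using assms(2,3) unfolding padic_integers_rat_def by blast
  have "x * y = of_int (a * c) / of_int (b * d)"
    unfolding ab cd by simp
  moreover have "\<not> int p dvd b * d"
    using ab cd assms(1) by (simp add: prime_dvd_mult_iff)
  ultimately show ?thesis unfolding padic_integers_rat_def by blast
qed

lemma padic_uminus [intro]:
  assumes "prime p" "x \<in> padic_integers_rat p"
  shows "- x \<in> padic_integers_rat p"
  using padic_mult[OF assms(1) padic_of_int[OF assms(1), of "-1"] assms(2)] by simp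

lemma padic_power [intro]:
  "prime p \<Longrightarrow> x \<in> padic_integers_rat p \<Longrightarrow> x ^ k \<in> padic_integers_rat p"
  by (induction k) auto

lemma padic_sum [intro]:
  "prime p \<Longrightarrow> (\<And>i. i \<in> S \<Longrightarrow> f i \<in> padic_integers_rat p) \<Longrightarrow> sum f S \<in> padic_integers_rat p"
  by (induction S rule: infinite_finite_induct) auto

lemma padic_divide:
  assumes "prime p" "x \<in> padic_integers_rat p" "\<not> p dvd d"
  shows "x / of_nat d \<in> padic_integers_rat p"
proof -
  have "1 / of_nat d \<in> padic_integers_rat p"
    unfolding padic_integers_rat_def
    by (rule CollectI, rule exI[of _ 1], rule exI[of _ "int d"]) (use assms(3) in auto)
  from padic_mult[OF assms(1,2) this] show ?thesis by simp
qed

lemma padic_divide_small: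
  assumes "prime p" "x \<in> padic_integers_rat p" "0 < d" "d < p"
  shows "x / of_nat d \<in> padic_integers_rat p"
  using assms by (intro padic_divide) (auto dest: dvd_imp_le)

section \<open>Power series with integral low coefficients\<close>

text \<open>Vanishing at \<open>0\<close> is included because it makes the \<open>N\<close>-th coefficient of a product
  of two such series depend only on coefficients of index below \<open>N\<close>.\<close>

definition integral_below :: "nat \<Rightarrow> nat \<Rightarrow> rat fps \<Rightarrow> bool" where
  "integral_below p N F \<longleftrightarrow> fps_nth F 0 = 0 \<and> (\<forall>m<N. fps_nth F m \<in> padic_integers_rat p)"

lemma integral_below_add:
  "prime p \<Longrightarrow> integral_below p N F \<Longrightarrow> integral_below p N G \<Longrightarrow> integral_below p N (F + G)"
  unfolding integral_below_def by auto

lemma integral_below_const_mult: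
  "prime p \<Longrightarrow> c \<in> padic_integers_rat p \<Longrightarrow> integral_below p N F \<Longrightarrow>
    integral_below p N (fps_const c * F)"
  unfolding integral_below_def by auto

lemma integral_below_mult_nth:
  assumes "prime p" "integral_below p N F" "integral_below p N G" "m \<le> N"
  shows "fps_nth (F * G) m \<in> padic_integers_rat p"
  unfolding fps_mult_nth
proof (rule padic_sum[OF assms(1)])
  fix i assume i: "i \<in> {0..m}"
  show "fps_nth F i * fps_nth G (m - i) \<in> padic_integers_rat p"
  proof (cases "i = 0 \<or> i = m")
    case True
    thus ?thesis using assms by (auto simp: integral_below_def)
  next
    case False
    hence "i < N" "m - i < N" using i assms(4) by auto
    thus ?thesis using assms by (intro padic_mult) (auto simp: integral_below_def)
  qed
qed

lemma integral_below_mult: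
  "prime p \<Longrightarrow> integral_below p N F \<Longrightarrow> integral_below p N G \<Longrightarrow> integral_below p N (F * G)"
  using integral_below_mult_nth[of p N F G] by (simp add: integral_below_def)

text \<open>The exponent is \<open>Suc k\<close> because \<open>F ^ 0 = 1\<close> does not vanish at
  0.\<close>

lemma integral_below_power:
  "prime p \<Longrightarrow> integral_below p N F \<Longrightarrow> integral_below p N (F ^ Suc k)"
  by (induction k) (auto intro: integral_below_mult simp del: power_Suc simp: power_Suc[of _ "Suc _"])

text \<open>For \<open>k >= 2\<close> the power is a product of two series without constant term, so
  \<open>fps_nth F N\<close>, which may fail to be integral, does not enter.\<close>

lemma integral_below_power_nth:
  assumes "prime p" "integral_below p N F" "k \<ge> 2"
  shows "fps_nth (F ^ k) N \<in> padic_integers_rat p"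
proof -
  obtain j where "k = Suc (Suc j)"
    using assms(3) by (metis Suc_le_D numeral_2_eq_2 Suc_le_mono)
  thus ?thesis
    using integral_below_mult_nth[OF assms(1,2) integral_below_power[OF assms(1,2), of j]] by simp
qed

section \<open>Bernoulli numbers\<close>

lemma bernoulli_0: "bernoulli 0 = 1"
  using bernoulli_recurrence[of 0] by simp

lemma bernoulli_1: "bernoulli 1 = - 1 / 2"
  using bernoulli_recurrence[of 1] by (simp add: bernoulli_0)

lemma bernoulli_fps_mult:
  "Abs_fps (\<lambda>n. bernoulli n / fact n) * (fps_exp 1 - 1) = fps_X"
proof -
  let ?E = "fps_exp 1 - 1 :: rat fps"
  have nth1: "fps_nth ?E 1 \<noteq> 0"
    by simp
  hence ne: "?E \<noteq> 0"
    by (metis fps_zero_nth)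
  have sub: "subdegree ?E = 1"
    using nth1 by (rule subdegreeI) simp
  have "?E dvd fps_X"
    using ne sub by (subst fps_dvd_iff) auto
  moreover have "Abs_fps (\<lambda>n. bernoulli n / fact n) = fps_X / ?E"
    by (rule fps_ext) (simp add: bernoulli_def)
  ultimately show ?thesis by simp
qed

lemma fps_exp_1_minus_1_nonzero: "fps_exp 1 - 1 \<noteq> (0 :: rat fps)"
proof
  assume "fps_exp 1 - 1 = (0 :: rat fps)"
  hence "fps_nth (fps_exp 1 - 1 :: rat fps) 1 = 0" by simp
  thus False by simp
qed

text \<open>The series \<open>f = X / (exp X - 1)\<close> satisfies \<open>f(-X) = f(X) + X\<close>,
  so \<open>f + X/2\<close> is even.\<close>

lemma bernoulli_odd:
  assumes "odd k" "k \<noteq> 1"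
  shows "bernoulli k = 0"
proof -
  define f where "f = Abs_fps (\<lambda>n. bernoulli n / fact n)"
  define e where "e = (fps_exp 1 :: rat fps)"
  note feq = bernoulli_fps_mult[folded f_def e_def]
  define g where "g = fps_compose f (-fps_X)"
  have "fps_compose e (-fps_X) = fps_exp (-1)"
    by (rule fps_ext) (simp add: fps_compose_uminus' e_def)
  hence e': "fps_compose e (-fps_X) * e = 1"
    using fps_exp_add_mult[of "-1 :: rat" 1] by (simp add: e_def)
  have "g * (fps_compose e (-fps_X) - 1) = -fps_X"
    using arg_cong[OF feq, of "\<lambda>h. fps_compose h (-fps_X)"]
    by (simp add: g_def fps_compose_mult_distrib fps_compose_sub_distrib)
  hence "g * (fps_compose e (-fps_X) - 1) * e = -fps_X * e" by simp
  hence "g * (fps_compose e (-fps_X) * e - e) = -fps_X * e" by (simp add: algebra_simps)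
  hence "g * (e - 1) = fps_X * e" unfolding e' by (simp add: algebra_simps)
  also have "\<dots> = (f + fps_X) * (e - 1)"
    using feq by (simp add: algebra_simps)
  finally have "g = f + fps_X"
    using fps_exp_1_minus_1_nonzero by (simp add: e_def)
  hence "fps_nth g k = fps_nth f k"
    using assms by (simp)
  moreover have "fps_nth g k = (-1) ^ k * fps_nth f k"
    unfolding g_def by (simp add: fps_compose_uminus')
  ultimately show ?thesis using assms(1) by (simp add: f_def)
qed

lemma div_bernoulli_odd:
  "odd k \<Longrightarrow> k \<noteq> 1 \<Longrightarrow> div_bernoulli k = 0"
  by (simp add: div_bernoulli_def bernoulli_odd)

text \<open>The recurrence yields \<open>bernoulli k\<close> from smaller indices with a single
  division, by \<open>k + 1 < p\<close>.\<close>

lemma bernoulli_integral: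
  assumes "prime p"
  shows "k + 1 < p \<Longrightarrow> bernoulli k \<in> padic_integers_rat p"
proof (induction k rule: less_induct)
  case (less k)
  show ?case
  proof (cases "k = 0")
    case True
    thus ?thesis using assms by (simp add: bernoulli_0)
  next
    case False
    have "(\<Sum>j<k. of_nat (Suc k choose j) * bernoulli j) + of_nat (Suc k) * bernoulli k = 0"
      using bernoulli_recurrence[of k] False by (simp add: lessThan_Suc_atMost[symmetric] del: of_nat_Suc)
    hence "bernoulli k = (- (\<Sum>j<k. of_nat (Suc k choose j) * bernoulli j)) / of_nat (Suc k)"
      by (simp add: field_simps del: of_nat_Suc)
    also have "\<dots> \<in> padic_integers_rat p"
      using less assms by (intro padic_divide_small padic_uminus padic_sum padic_mult padic_of_nat) auto
    finally show ?thesis .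
  qed
qed

text \<open>Up to the factor \<open>fact m\<close>, both sides are the coefficient of
  \<open>X^m\<close> in the geometric sum \<open>1 + exp X + ... + exp ((p-1) X) = (exp (p X) - 1) /
  (exp X - 1)\<close>.\<close>

lemma sum_powers_bernoulli:
  assumes "m > 0"
  shows "(\<Sum>i=1..<p. of_nat i ^ m) =
    (\<Sum>k\<le>m. of_nat (m choose k) * bernoulli k * of_nat p ^ (m + 1 - k) / of_nat (m + 1 - k))"
proof -
  let ?f = "Abs_fps (\<lambda>n. bernoulli n / fact n)"
  define S :: "rat fps" where "S = (\<Sum>i<p. fps_exp (of_nat i))"
  define Q :: "rat fps" where "Q = Abs_fps (\<lambda>n. of_nat p ^ (n + 1) / fact (n + 1))"
  have tel: "S * (fps_exp 1 - 1) = fps_exp (of_nat p) - 1"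
    unfolding S_def by (induction p) (simp_all add: algebra_simps fps_exp_add_mult)
  have Q: "fps_X * Q = fps_exp (of_nat p) - 1"
    by (rule fps_ext) (auto simp: Q_def gr0_conv_Suc simp del: fact_Suc)
  have "S * (fps_exp 1 - 1) = ?f * Q * (fps_exp 1 - 1)"
    unfolding tel Q[symmetric] by (subst bernoulli_fps_mult[symmetric]) (simp only: mult_ac)
  hence SQ: "S = ?f * Q"
    using fps_exp_1_minus_1_nonzero by simp
  \<comment> \<open>The added term for \<open>i = 0\<close> is \<open>0 ^ m\<close>, which vanishes
    because \<open>m > 0\<close>.\<close>
  have "(\<Sum>i=1..<p. of_nat i ^ m) = (\<Sum>i<p. of_nat i ^ m :: rat)"
    using assms by (intro sum.mono_neutral_left) (auto simp: not_le Suc_le_eq)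
  also have "\<dots> = fact m * fps_nth S m"
    by (simp add: S_def fps_sum_nth sum_distrib_left)
  also have "\<dots> = (\<Sum>k\<le>m. fact m * (bernoulli k / fact k * (of_nat p ^ (m - k + 1) / fact (m - k + 1))))"
    unfolding SQ by (simp add: fps_mult_nth Q_def sum_distrib_left atMost_atLeast0)
  also have "\<dots> = (\<Sum>k\<le>m. of_nat (m choose k) * bernoulli k * of_nat p ^ (m + 1 - k) / of_nat (m + 1 - k))"
  proof (rule sum.cong[OF refl])
    fix k assume k: "k \<in> {..m}"
    have "(of_nat (m choose k) :: rat) = fact m / (fact k * fact (m - k))"
      using k by (intro binomial_fact) auto
    moreover have "m + 1 - k = Suc (m - k)" using k by auto
    ultimately show "fact m * (bernoulli k / fact k * (of_nat p ^ (m - k + 1) / fact (m - k + 1))) =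
      of_nat (m choose k) * bernoulli k * of_nat p ^ (m + 1 - k) / of_nat (m + 1 - k)"
      by (simp add: mult_ac)
  qed
  finally show ?thesis .
qed

section \<open>The logarithm of the generating function\<close>

text \<open>Division by zero makes the constant term \<open>0\<close>, as required for the composition with \<open>exp\<close>;
  likewise for \<open>log_coeff1\<close> and \<open>log_rest\<close> below.\<close>

definition log_prod :: "nat \<Rightarrow> rat fps" where
  "log_prod p = Abs_fps (\<lambda>m. (- 1) ^ (m + 1) * (\<Sum>i=1..<p. of_nat i ^ m) / of_nat m)"

text \<open>Comparing coefficients of \<open>X^m\<close> in \<open>F' = F H\<close> determines
  coefficient \<open>m + 1\<close> of \<open>F\<close> from those of index at most
  \<open>m\<close>.\<close>

lemma fps_ode_unique:
  fixes F G H :: "'a :: {field_char_0} fps"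
  assumes "fps_deriv F = F * H" "fps_deriv G = G * H" "fps_nth F 0 = fps_nth G 0"
  shows "F = G"
proof (rule fps_ext)
  fix n show "fps_nth F n = fps_nth G n"
  proof (induction n rule: less_induct)
    case (less n)
    show ?case
    proof (cases n)
      case 0
      thus ?thesis using assms(3) by simp
    next
      case (Suc m)
      have "fps_nth (F * H) m = fps_nth (G * H) m"
        using less Suc by (simp add: fps_mult_nth)
      hence "fps_nth (fps_deriv F) m = fps_nth (fps_deriv G) m"
        using assms by simp
      thus ?thesis using Suc by (simp del: of_nat_Suc)
    qed
  qed
qed

text \<open>Each summand is the geometric series of \<open>i / (1 + i X)\<close>, the derivative of
  \<open>log (1 + i X)\<close>.\<close>

lemma fps_deriv_log_prod:
  "fps_deriv (log_prod p) = (\<Sum>i=1..<p. Abs_fps (\<lambda>m. of_nat i * (- of_nat i) ^ m))"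
  by (rule fps_ext) (simp add: log_prod_def fps_sum_nth sum_distrib_left sum_divide_distrib power_minus[of "of_nat _"] mult_ac
      del: of_nat_Suc)

text \<open>Both sides have constant term 1 and logarithmic derivative
  \<open>fps_deriv (log_prod p)\<close>.\<close>

lemma prod_eq_exp_log_prod:
  "(\<Prod>i=1..<p. 1 + of_nat i * fps_X) = fps_compose (fps_exp 1) (log_prod p)"
proof (rule fps_ode_unique)
  let ?G = "\<lambda>i. Abs_fps (\<lambda>m. of_nat i * (- of_nat i) ^ m) :: rat fps"
  have "(1 + fps_const c * fps_X) * Abs_fps (\<lambda>m. c * (- c) ^ m) = fps_const c" for c :: rat
  proof (rule fps_ext)
    fix m show "fps_nth ((1 + fps_const c * fps_X) * Abs_fps (\<lambda>m. c * (- c) ^ m)) m = fps_nth (fps_const c) m"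
      by (cases m) (simp_all add: ring_distribs mult.assoc)
  qed
  hence geo: "(1 + of_nat i * fps_X) * ?G i = of_nat i" for i
    by (metis fps_of_nat)
  show "fps_deriv (\<Prod>i=1..<p. 1 + of_nat i * fps_X) =
    (\<Prod>i=1..<p. 1 + of_nat i * fps_X) * fps_deriv (log_prod p)"
    unfolding fps_deriv_log_prod
  proof (induction p)
    case (Suc p)
    show ?case
    proof (cases "p = 0")
      case False
      define A where "A = (\<Prod>i=1..<p. 1 + of_nat i * fps_X :: rat fps)"
      define D where "D = (\<Sum>i=1..<p. ?G i)"
      have "fps_deriv (A * (1 + of_nat p * fps_X)) = A * D * (1 + of_nat p * fps_X) + A * of_nat p"
        using Suc by (simp add: A_def D_def algebra_simps)
      also have "\<dots> = A * (1 + of_nat p * fps_X) * (D + ?G p)"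
        by (subst geo[symmetric]) (simp only: ring_distribs mult_ac)
      finally show ?thesis using False by (simp add: A_def D_def)
    qed simp
  qed simp
  show "fps_deriv (fps_compose (fps_exp 1) (log_prod p)) =
    fps_compose (fps_exp 1) (log_prod p) * fps_deriv (log_prod p)"
    by (subst fps_compose_deriv) (simp_all add: log_prod_def)
  show "fps_nth (\<Prod>i=1..<p. 1 + of_nat i * fps_X) 0 = fps_nth (fps_compose (fps_exp 1) (log_prod p)) 0"
    by (induction p) (simp_all add: prod.atLeastLessThan_Suc split: nat.split)
qed

text \<open>Expanding the product, a subset \<open>I\<close> records the factors from which the term
  \<open>i X\<close> is taken.\<close>

lemma A_sym_eq_prod_nth:
  "of_nat (A_sym p k) = fps_nth (\<Prod>i=1..<p. 1 + of_nat i * fps_X :: rat fps) k"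
proof -
  have fin: "finite I" if "I \<in> Pow {1..<p}" for I using that by (auto intro: finite_subset)
  have "(\<Prod>i=1..<p. 1 + of_nat i * fps_X :: rat fps) = (\<Prod>i=1..<p. of_nat i * fps_X + 1)"
    by (simp add: add.commute)
  also have "\<dots> = (\<Sum>I\<in>Pow {1..<p}. fps_const (of_nat (\<Prod>I)) * fps_X ^ card I)"
    by (subst prod_add) (auto simp: prod.distrib fps_of_nat simp flip: of_nat_prod)
  finally have "fps_nth (\<Prod>i=1..<p. 1 + of_nat i * fps_X :: rat fps) k
      = (\<Sum>I\<in>Pow {1..<p}. if card I = k then of_nat (\<Prod>I) else 0)"
    by (simp add: fps_sum_nth fps_X_power_nth eq_commute[of k] if_distrib cong: if_cong)
  also have "\<dots> = (\<Sum>I | I \<in> Pow {1..<p} \<and> card I = k. of_nat (\<Prod>I))"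
    by (rule sum.inter_filter[symmetric]) simp
  also have "{I. I \<in> Pow {1..<p} \<and> card I = k} = {I. I \<subseteq> {1..p - 1} \<and> card I = k}"
    by (cases p) (auto simp: atLeastLessThanSuc_atLeastAtMost)
  finally show ?thesis by (simp add: A_sym_def)
qed

lemma A_sym_eq_sum_log_prod:
  "of_nat (A_sym p k) = (\<Sum>j=0..k. fps_nth (log_prod p ^ j) k / fact j)"
  unfolding A_sym_eq_prod_nth prod_eq_exp_log_prod by (simp add: fps_compose_nth)

section \<open>Expansion of the logarithm in powers of \<open>p\<close>\<close>

text \<open>The series \<open>U\<close>, \<open>V\<close>, \<open>W\<close>, \<open>Z\<close> are
  \<open>log_coeff1\<close>, \<open>log_coeff2\<close>, \<open>log_coeff3\<close>,
  \<open>log_rest p\<close>. They come from the Faulhaber terms with \<open>k = m\<close>,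
  \<open>k = m - 1\<close>, \<open>k = m - 2\<close> and all smaller \<open>k\<close>.\<close>

definition log_coeff1 :: "rat fps" where
  "log_coeff1 = Abs_fps (\<lambda>m. (- 1) ^ (m + 1) * div_bernoulli m)"

text \<open>At \<open>m = 0\<close> the truncated index \<open>m - 1\<close> would produce
  \<open>bernoulli 0 = 1\<close>, hence the case distinction.\<close>

definition log_coeff2 :: "rat fps" where
  "log_coeff2 = Abs_fps (\<lambda>m. if m = 0 then 0 else (- 1) ^ (m + 1) * bernoulli (m - 1) / 2)"

text \<open>The factor \<open>of_nat (m - 1)\<close> kills the coefficients at 0 and 1, where
  \<open>m - 2\<close> truncates.\<close>

definition log_coeff3 :: "rat fps" where
  "log_coeff3 = Abs_fps (\<lambda>m. (- 1) ^ (m + 1) * of_nat (m - 1) * bernoulli (m - 2) / 6)"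

definition log_rest :: "nat \<Rightarrow> rat fps" where
  "log_rest p = Abs_fps (\<lambda>m. (- 1) ^ (m + 1) / of_nat m *
     (\<Sum>k<m - 2. of_nat (m choose k) * bernoulli k * of_nat p ^ (m - 3 - k) / of_nat (m + 1 - k)))"

lemma log_prod_expansion:
  "log_prod p = fps_const (of_nat p) * log_coeff1 + fps_const (of_nat p ^ 2) * log_coeff2
    + fps_const (of_nat p ^ 3) * log_coeff3 + fps_const (of_nat p ^ 4) * log_rest p"
proof (rule fps_ext)
  fix m
  define t where "t k = of_nat (m choose k) * bernoulli k * of_nat p ^ (m + 1 - k) / of_nat (m + 1 - k)" for k
  let ?r = "\<lambda>k. of_nat (m choose k) * bernoulli k * of_nat p ^ (m - 3 - k) / of_nat (m + 1 - k) :: rat"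
  \<comment> \<open>All three leading Faulhaber terms exist only for \<open>m >= 2\<close>.\<close>
  consider "m = 0" | "m = 1" | "m \<ge> 2" by linarith
  thus "fps_nth (log_prod p) m = fps_nth (fps_const (of_nat p) * log_coeff1 + fps_const (of_nat p ^ 2) * log_coeff2
    + fps_const (of_nat p ^ 3) * log_coeff3 + fps_const (of_nat p ^ 4) * log_rest p) m"
  proof cases
    case 1
    thus ?thesis
      by (simp add: log_prod_def log_coeff1_def log_coeff2_def log_coeff3_def log_rest_def div_bernoulli_def)
  next
    case 2
    have "(\<Sum>i=1..<p. of_nat i :: rat) = of_nat p ^ 2 / 2 + bernoulli 1 * of_nat p"
      using sum_powers_bernoulli[of 1 p] by (simp add: bernoulli_0 power2_eq_square)
    thus ?thesis using 2
      by (simp add: log_prod_def log_coeff1_def log_coeff2_def log_coeff3_def log_rest_def div_bernoulli_def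
          bernoulli_0)
  next
    case 3
    then obtain j where j: "m = Suc (Suc j)" by (metis Suc_le_D numeral_2_eq_2 Suc_le_mono)
    have "{..m} = {..<Suc (Suc (Suc j))}" using j by auto
    hence power_sum: "(\<Sum>i=1..<p. of_nat i ^ m) = (\<Sum>k<j. t k) + t j + t (Suc j) + t (Suc (Suc j))"
      using sum_powers_bernoulli[of m p] 3 by (simp add: t_def)
    have t_rest: "(\<Sum>k<j. t k) = of_nat p ^ 4 * (\<Sum>k<j. ?r k)"
      unfolding sum_distrib_left
    proof (rule sum.cong[OF refl])
      fix k assume "k \<in> {..<j}"
      \<comment> \<open>Here \<open>k < m - 2\<close>, so the exponent is at least 4 and no
        subtraction truncates.\<close>
      hence "m + 1 - k = 4 + (m - 3 - k)" using j by auto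
      hence "(of_nat p :: rat) ^ (m + 1 - k) = of_nat p ^ 4 * of_nat p ^ (m - 3 - k)"
        by (simp only: power_add)
      thus "t k = of_nat p ^ 4 * ?r k" by (simp add: t_def)
    qed
    have t_1: "t (Suc (Suc j)) / of_nat m = of_nat p * div_bernoulli m"
      by (simp add: t_def j div_bernoulli_def del: of_nat_Suc)
    have t_2: "t (Suc j) / of_nat m = of_nat p ^ 2 * bernoulli (m - 1) / 2"
    proof -
      have "m choose Suc j = m" unfolding j by (subst binomial_symmetric) auto
      moreover have "m + 1 - Suc j = 2" using j by simp
      ultimately show ?thesis unfolding t_def by (simp add: j del: of_nat_Suc binomial_Suc_Suc)
    qed
    have t_3: "t j / of_nat m = of_nat p ^ 3 * (of_nat (m - 1) * bernoulli (m - 2) / 6)"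
    proof -
      have "m choose j = m choose 2" unfolding j by (subst binomial_symmetric) auto
      moreover have "2 * (m choose 2) = m * (m - 1)"
        unfolding choose_two by (rule dvd_mult_div_cancel) (cases m; simp)
      ultimately have "2 * (of_nat (m choose j) :: rat) = of_nat m * of_nat (m - 1)"
        by (metis of_nat_mult of_nat_numeral)
      hence "(of_nat (m choose j) :: rat) = of_nat m * of_nat (m - 1) / 2" by simp
      moreover have "m + 1 - j = 3" using j by simp
      ultimately have "t j = of_nat m * of_nat (m - 1) / 2 * bernoulli (m - 2) * of_nat p ^ 3 / 3"
        unfolding t_def by (simp only:) (simp add: j)
      thus ?thesis using 3 by simp
    qed
    define c where "c = of_nat (m - 1) * bernoulli (m - 2) / 6"
    define r where "r = (\<Sum>k<j. ?r k)"
    define \<epsilon> :: rat where "\<epsilon> = (- 1) ^ (m + 1)"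
    have "(\<Sum>i=1..<p. of_nat i ^ m) / of_nat m = of_nat p * div_bernoulli m
      + of_nat p ^ 2 * bernoulli (m - 1) / 2 + of_nat p ^ 3 * c + of_nat p ^ 4 * (r / of_nat m)"
      unfolding power_sum add_divide_distrib t_1 t_2 t_3 t_rest c_def r_def by simp
    moreover have "fps_nth (log_prod p) m = \<epsilon> * ((\<Sum>i=1..<p. of_nat i ^ m) / of_nat m)"
      by (simp add: log_prod_def \<epsilon>_def)
    moreover have "fps_nth log_coeff1 m = \<epsilon> * div_bernoulli m"
      by (simp add: log_coeff1_def \<epsilon>_def)
    moreover have "fps_nth log_coeff2 m = \<epsilon> * (bernoulli (m - 1) / 2)"
      using 3 by (simp add: log_coeff2_def \<epsilon>_def)
    moreover have "fps_nth log_coeff3 m = \<epsilon> * c"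
      by (simp add: log_coeff3_def \<epsilon>_def c_def)
    moreover have "fps_nth (log_rest p) m = \<epsilon> * (r / of_nat m)"
    proof -
      have "m - 2 = j" using j by simp
      thus ?thesis by (simp only: log_rest_def \<epsilon>_def r_def fps_nth_Abs_fps) simp
    qed
    ultimately show ?thesis by (simp add: algebra_simps)
  qed
qed

section \<open>Integrality of the four coefficient series\<close>

context
  fixes p :: nat
  assumes p: "prime p" "p \<ge> 7"
begin

lemma log_coeff1_integral:
  assumes "m + 1 < p"
  shows "fps_nth log_coeff1 m \<in> padic_integers_rat p"
proof (cases "m = 0")
  case False
  have "bernoulli m / of_nat m \<in> padic_integers_rat p"
    using assms p False by (intro padic_divide_small bernoulli_integral) auto
  moreover have "(-1) ^ (m + 1) \<in> padic_integers_rat p"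
    using p by (intro padic_power padic_uminus) auto
  ultimately show ?thesis
    using p unfolding log_coeff1_def div_bernoulli_def fps_nth_Abs_fps by (intro padic_mult)
qed (use p in \<open>simp add: log_coeff1_def div_bernoulli_def\<close>)

text \<open>The Bernoulli index is one below \<open>m\<close>, so even \<open>m = p - 1\<close>
  stays clear of \<open>bernoulli (p - 1)\<close>.\<close>

lemma log_coeff2_integral:
  assumes "m < p"
  shows "fps_nth log_coeff2 m \<in> padic_integers_rat p"
proof (cases "m = 0")
  case False
  have "(-1) ^ (m + 1) * bernoulli (m - 1) / of_nat 2 \<in> padic_integers_rat p"
    using assms p False
    by (intro padic_divide_small bernoulli_integral padic_mult padic_power padic_uminus) auto
  thus ?thesis using False by (simp add: log_coeff2_def)
qed (use p in \<open>simp add: log_coeff2_def\<close>)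

lemma log_coeff3_integral:
  assumes "m < p"
  shows "fps_nth log_coeff3 m \<in> padic_integers_rat p"
proof -
  have "(-1) ^ (m + 1) * of_nat (m - 1) * bernoulli (m - 2) / of_nat 6 \<in> padic_integers_rat p"
    using assms p
    by (intro padic_divide_small bernoulli_integral padic_mult padic_power padic_uminus padic_of_nat) auto
  thus ?thesis by (simp add: log_coeff3_def)
qed

lemma log_rest_integral:
  assumes "m < p"
  shows "fps_nth (log_rest p) m \<in> padic_integers_rat p"
proof (cases "m = 0")
  case False
  have summand: "of_nat (m choose k) * bernoulli k * of_nat p ^ (m - 3 - k) / of_nat (m + 1 - k)
      \<in> padic_integers_rat p" if k: "k < m - 2" for k
  proof -
    have B: "bernoulli k \<in> padic_integers_rat p"
      using k assms p by (intro bernoulli_integral) auto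
    show ?thesis
    proof (cases "m + 1 - k = p")
      \<comment> \<open>As \<open>m < p\<close>, this happens only for \<open>m = p - 1\<close> and
        \<open>k = 0\<close>; one factor of \<open>p ^ (p - 4)\<close> cancels the
        denominator.\<close>
      case True
      hence "m - 3 - k = Suc (m - 4 - k)" using p by auto
      hence "(of_nat p :: rat) ^ (m - 3 - k) / of_nat (m + 1 - k) = of_nat p ^ (m - 4 - k)"
        using True p by simp
      moreover have "of_nat (m choose k) * bernoulli k * of_nat p ^ (m - 4 - k) \<in> padic_integers_rat p"
        using p B by (intro padic_mult padic_power padic_of_nat)
      ultimately show ?thesis by (metis times_divide_eq_right)
    next
      case False
      thus ?thesis using assms k p B
        by (intro padic_divide_small padic_mult padic_power padic_of_nat) auto
    qed
  qed
  let ?s = "\<Sum>k<m - 2. of_nat (m choose k) * bernoulli k * of_nat p ^ (m - 3 - k) / of_nat (m + 1 - k)"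
  have "(-1) ^ (m + 1) * ?s / of_nat m \<in> padic_integers_rat p"
  proof (intro padic_divide_small padic_mult padic_power padic_uminus)
    show "?s \<in> padic_integers_rat p"
      using p summand by (intro padic_sum) auto
  qed (use False assms p in auto)
  thus ?thesis by (simp add: log_rest_def)
qed (use p in \<open>simp add: log_rest_def\<close>)

end

lemma log_coeff_nth_0 [simp]:
  "fps_nth log_coeff1 0 = 0" "fps_nth log_coeff2 0 = 0" "fps_nth log_coeff3 0 = 0"
  "fps_nth (log_rest p) 0 = 0"
  by (simp_all add: log_coeff1_def log_coeff2_def log_coeff3_def log_rest_def div_bernoulli_def)

section \<open>Coefficients of the products\<close>

text \<open>This is \<open>-U\<close> without its linear term. The cutoff at 2 matches the index
  ranges of \<open>C_sum\<close> and \<open>T_sum\<close>, which thus become coefficients of its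
  square and cube.\<close>

definition div_bernoulli_fps :: "rat fps" where
  "div_bernoulli_fps = Abs_fps (\<lambda>m. if m < 2 then 0 else div_bernoulli m)"

lemma div_bernoulli_fps_square_nth: "fps_nth (div_bernoulli_fps ^ 2) m = C_sum m"
  unfolding C_sum_def power2_eq_square fps_mult_nth
  by (rule sum.mono_neutral_cong_right) (auto simp: div_bernoulli_fps_def)

text \<open>One of \<open>i\<close> and \<open>m - i\<close> is odd, and both are at least
  2.\<close>

lemma C_sum_odd:
  assumes "odd m"
  shows "C_sum m = 0"
  unfolding C_sum_def
proof (intro sum.neutral ballI)
  fix i assume i: "i \<in> {2..m - 2}"
  show "div_bernoulli i * div_bernoulli (m - i) = 0"
  proof (cases "odd i")
    case True
    thus ?thesis using i by (auto simp: div_bernoulli_odd)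
  next
    case False
    hence "odd (m - i)" "m - i \<noteq> 1" using i assms by auto
    thus ?thesis by (simp add: div_bernoulli_odd)
  qed
qed

lemma C_sum_less_4: "m < 4 \<Longrightarrow> C_sum m = 0"
  by (simp add: C_sum_def)

lemma div_bernoulli_fps_cube_nth: "fps_nth (div_bernoulli_fps ^ 3) m = T_sum m"
proof -
  have "fps_nth (div_bernoulli_fps * div_bernoulli_fps ^ 2) m = T_sum m"
    unfolding T_sum_def fps_mult_nth div_bernoulli_fps_square_nth
    by (rule sum.mono_neutral_cong_right) (auto simp: div_bernoulli_fps_def not_le intro: C_sum_less_4)
  thus ?thesis by (simp add: power3_eq_cube power2_eq_square mult_ac)
qed

text \<open>From index 2 on, only even indices survive, with sign -1; the linear term comes from
  \<open>bernoulli 1 = -1/2\<close>.\<close>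

lemma log_coeff1_eq: "log_coeff1 = - (div_bernoulli_fps + fps_const (1 / 2) * fps_X)"
proof (rule fps_ext)
  fix m :: nat
  consider "m = 0" | "m = 1" | "m \<ge> 2" "even m" | "m \<ge> 2" "odd m" by linarith
  thus "fps_nth log_coeff1 m = fps_nth (- (div_bernoulli_fps + fps_const (1 / 2) * fps_X)) m"
    by cases (auto simp: log_coeff1_def div_bernoulli_fps_def div_bernoulli_odd div_bernoulli_def[of 0] div_bernoulli_def[of "Suc 0"] bernoulli_1[simplified])
qed

text \<open>The mixed term of the square involves the odd index \<open>N - 1\<close>, and
  \<open>X^2\<close> lies below degree \<open>N\<close>.\<close>

lemma log_coeff1_square_nth:
  assumes "even N" "N \<ge> 4"
  shows "fps_nth (log_coeff1 ^ 2) N = C_sum N"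
proof -
  have "log_coeff1 ^ 2 = div_bernoulli_fps ^ 2 + fps_const 2 * fps_const (1 / 2) * (div_bernoulli_fps * fps_X)
    + fps_const (1 / 2) ^ 2 * fps_X ^ 2"
    unfolding log_coeff1_eq numeral_fps_const[symmetric] by algebra
  moreover have "fps_nth div_bernoulli_fps (N - 1) = 0"
    using assms by (simp add: div_bernoulli_fps_def div_bernoulli_odd)
  ultimately show ?thesis using assms
    by (simp add: div_bernoulli_fps_square_nth mult.assoc del: fps_const_mult)
qed

text \<open>Write \<open>D\<close> for \<open>div_bernoulli_fps\<close>. In
  \<open>-(D + X/2)^3\<close> the term with \<open>D^2 X\<close> gives
  \<open>C_sum (N - 1) = 0\<close>, the term with \<open>D X^2\<close> gives the 3/4, and
  \<open>X^3\<close> lies below degree \<open>N\<close>.\<close>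

lemma log_coeff1_cube_nth:
  assumes "even N" "N \<ge> 6"
  shows "fps_nth (log_coeff1 ^ 3) N = - T_sum N - 3 / 4 * div_bernoulli (N - 2)"
proof -
  have "log_coeff1 ^ 3 = - (div_bernoulli_fps ^ 3
    + fps_const 3 * fps_const (1 / 2) * (div_bernoulli_fps ^ 2 * fps_X)
    + fps_const 3 * fps_const (1 / 2) ^ 2 * (div_bernoulli_fps * fps_X ^ 2)
    + fps_const (1 / 2) ^ 3 * fps_X ^ 3)"
    unfolding log_coeff1_eq numeral_fps_const[symmetric] by algebra
  moreover have "fps_nth div_bernoulli_fps (N - 2) = div_bernoulli (N - 2)"
    using assms by (simp add: div_bernoulli_fps_def)
  ultimately show ?thesis using assms
    by (simp add: div_bernoulli_fps_square_nth div_bernoulli_fps_cube_nth C_sum_odd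
        fps_X_power_mult_right_nth power_divide)
qed

text \<open>\<open>U\<close> lives on index 1 and even indices, \<open>V\<close> on index 2 and odd
  ones. For even \<open>N\<close> this leaves \<open>i = 1\<close> and \<open>i = N - 2\<close>,
  each with one factor \<open>bernoulli 1\<close>.\<close>

lemma log_coeff1_log_coeff2_nth:
  assumes "even N" "N \<ge> 6"
  shows "fps_nth (log_coeff1 * log_coeff2) N =
    - (bernoulli (N - 2) + div_bernoulli (N - 2)) / 4"
proof -
  have "fps_nth (log_coeff1 * log_coeff2) N =
    (\<Sum>i\<in>{1, N - 2}. fps_nth log_coeff1 i * fps_nth log_coeff2 (N - i))"
    unfolding fps_mult_nth
  proof (intro sum.mono_neutral_right ballI)
    fix i assume i: "i \<in> {0..N} - {1, N - 2}"
    show "fps_nth log_coeff1 i * fps_nth log_coeff2 (N - i) = 0"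
    proof (cases "odd i \<or> i = N")
      case True
      thus ?thesis using i by (auto simp: log_coeff1_def log_coeff2_def div_bernoulli_odd)
    next
      case False
      hence "odd (N - i - 1)" "N - i - 1 \<noteq> 1" using i assms by auto
      thus ?thesis by (simp add: log_coeff2_def bernoulli_odd)
    qed
  qed (use assms in auto)
  also have "\<dots> = - (bernoulli (N - 2) + div_bernoulli (N - 2)) / 4"
  proof -
    obtain j where j: "N = Suc (Suc (Suc j))"
      using assms(2) by (intro that[of "N - 3"]) simp
    have "j \<noteq> 0" "odd j" using assms by (auto simp: j)
    moreover have "bernoulli (Suc 0) = - 1 / 2" using bernoulli_1 by simp
    ultimately show ?thesis
      by (simp add: log_coeff1_def log_coeff2_def div_bernoulli_def[of "Suc 0"] j)
  qed
  finally show ?thesis .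
qed

section \<open>The congruence modulo \<open>p^4\<close>\<close>

theorem theorem1:
  fixes p n :: nat
  assumes "prime p" and "odd p"
    and "6 \<le> 2 * n" and "2 * n \<le> p - 1"
  shows "padic_cong p 4
    (of_nat (A_sym p (2 * n)))
    (of_nat p ^ 2 / 2 * C_sum (2 * n)
      - of_nat p * div_bernoulli (2 * n)
      - of_nat p ^ 3 / 6 * T_sum (2 * n)
      - (16 * of_nat n ^ 2 - 12 * of_nat n + 5) / 24 * of_nat p ^ 3 * div_bernoulli (2 * n - 2))"
proof -
  define N where "N = 2 * n"
  have N: "even N" "N \<ge> 6" "N < p" using assms by (auto simp: N_def)
  have p: "prime p" "p \<ge> 7" using assms by auto
  define P :: rat where "P = of_nat p"
  have PR: "P \<in> padic_integers_rat p" using p by (simp add: P_def)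
  let ?R = "padic_integers_rat p"
  let ?U = log_coeff1 and ?V = log_coeff2 and ?W = log_coeff3 and ?Z = "log_rest p"
  \<comment> \<open>The bound \<open>N\<close> leaves out the coefficient of \<open>U\<close> at
    \<open>N\<close> itself, which is not integral when \<open>N = p - 1\<close>.\<close>
  have ib: "integral_below p N ?U" "integral_below p N ?V" "integral_below p N ?W" "integral_below p N ?Z"
    using N p by (auto simp: integral_below_def intro: log_coeff1_integral log_coeff2_integral
        log_coeff3_integral log_rest_integral)
  \<comment> \<open>Nested tails of \<open>L / p\<close>: each one peels off a further power of
    \<open>p\<close>.\<close>
  define Y where "Y = ?W + fps_const P * ?Z"
  define M' where "M' = ?V + fps_const P * Y"
  define M where "M = ?U + fps_const P * M'"
  have ibY: "integral_below p N Y" unfolding Y_def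
    using p ib PR by (intro integral_below_add integral_below_const_mult) auto
  have ibM': "integral_below p N M'" unfolding M'_def
    using p ib ibY PR by (intro integral_below_add integral_below_const_mult) auto
  have ibM: "integral_below p N M" unfolding M_def
    using p ib ibM' PR by (intro integral_below_add integral_below_const_mult) auto
  have LM: "log_prod p = fps_const P * M"
    unfolding log_prod_expansion M_def M'_def Y_def P_def[symmetric]
    by (simp add: ring_distribs mult.assoc[symmetric] power2_eq_square power3_eq_cube power4_eq_xxxx)

  have LM_nth: "fps_nth (log_prod p ^ k) N = P ^ k * fps_nth (M ^ k) N" for k
    by (simp add: LM power_mult_distrib)

  define z1 where "z1 = fps_nth ?Z N"
  have z1: "z1 \<in> ?R" unfolding z1_def using N p by (intro log_rest_integral) auto
  \<comment> \<open>The possibly non-integral coefficient of \<open>U\<close> is kept exactly here;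
    it cancels against the term with \<open>div_bernoulli N\<close> in the claim.\<close>
  have c1: "fps_nth (log_prod p) N = P * fps_nth ?U N + P ^ 2 * fps_nth ?V N + P ^ 3 * fps_nth ?W N + P ^ 4 * z1"
    unfolding log_prod_expansion by (simp add: P_def z1_def)

  \<comment> \<open>What remains of \<open>M^2\<close> beyond \<open>U^2 + 2 p U V\<close> carries
    \<open>p^2\<close>, and \<open>L^2 = p^2 M^2\<close> supplies the other two factors.\<close>
  define z2 where "z2 = 2 * fps_nth (?U * Y) N + fps_nth (M' * M') N"
  have z2: "z2 \<in> ?R" unfolding z2_def
    using p padic_of_nat[OF p(1), of 2] ib ibY ibM'
    by (intro padic_add padic_mult[of p 2] integral_below_mult_nth) auto
  have "M ^ 2 = ?U ^ 2 + fps_const 2 * (fps_const P * (?U * ?V))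
      + fps_const P ^ 2 * (fps_const 2 * (?U * Y) + M' * M')"
    unfolding M_def M'_def numeral_fps_const[symmetric] by algebra
  hence c2: "fps_nth (log_prod p ^ 2) N =
      P ^ 2 * fps_nth (?U ^ 2) N + 2 * P ^ 3 * fps_nth (?U * ?V) N + P ^ 4 * z2"
    unfolding LM_nth z2_def by (simp only: fps_add_nth fps_mult_left_const_nth fps_const_power)
      (simp add: algebra_simps power2_eq_square power3_eq_cube power4_eq_xxxx)

  \<comment> \<open>This factors \<open>M^3 - U^3\<close> using \<open>M - U = p M'\<close>.\<close>
  define z3 where "z3 = fps_nth (M' * (?U * ?U + ?U * M + M * M)) N"
  have z3: "z3 \<in> ?R" unfolding z3_def
    using p ib ibM ibM' by (intro integral_below_mult_nth integral_below_add integral_below_mult) auto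
  have "M ^ 3 = ?U ^ 3 + fps_const P * (M' * (?U * ?U + ?U * M + M * M))"
    unfolding M_def by algebra
  hence c3: "fps_nth (log_prod p ^ 3) N = P ^ 3 * fps_nth (?U ^ 3) N + P ^ 4 * z3"
    unfolding LM_nth z3_def by (simp only: fps_add_nth fps_mult_left_const_nth)
      (simp add: algebra_simps power3_eq_cube power4_eq_xxxx)

  \<comment> \<open>For \<open>j >= 4\<close> the power \<open>L^j = p^j M^j\<close> already carries
    \<open>p^4\<close>, and \<open>j <= N < p\<close> keeps \<open>fact j\<close> prime to
    \<open>p\<close>.\<close>
  define z4 where "z4 = (\<Sum>j=4..N. P ^ (j - 4) * fps_nth (M ^ j) N / of_nat (fact j))"
  have z4: "z4 \<in> ?R" unfolding z4_def
  proof (intro padic_sum padic_divide padic_mult padic_power integral_below_power_nth)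
    fix j assume "j \<in> {4..N}"
    thus "\<not> p dvd fact j" using N p by (simp add: prime_dvd_fact_iff)
  qed (use p PR ibM in auto)
  have c4: "(\<Sum>j=4..N. fps_nth (log_prod p ^ j) N / fact j) = P ^ 4 * z4"
    unfolding z4_def sum_distrib_left
  proof (rule sum.cong[OF refl])
    fix j assume "j \<in> {4..N}"
    hence "P ^ j = P ^ 4 * P ^ (j - 4)" by (simp flip: power_add)
    thus "fps_nth (log_prod p ^ j) N / fact j = P ^ 4 * (P ^ (j - 4) * fps_nth (M ^ j) N / of_nat (fact j))"
      by (simp add: LM_nth)
  qed

  have "{0..N} = {0, 1, 2, 3} \<union> {4..N}" using N by auto
  hence "of_nat (A_sym p N) = (\<Sum>j\<in>{0, 1, 2, 3}. fps_nth (log_prod p ^ j) N / fact j)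
      + (\<Sum>j=4..N. fps_nth (log_prod p ^ j) N / fact j)"
    unfolding A_sym_eq_sum_log_prod by (simp only:) (rule sum.union_disjoint; auto)
  \<comment> \<open>The term \<open>j = 0\<close> is the coefficient of the series 1 in degree
    \<open>N > 0\<close>.\<close>
  also have "\<dots> = fps_nth (log_prod p) N + fps_nth (log_prod p ^ 2) N / 2
      + fps_nth (log_prod p ^ 3) N / 6 + P ^ 4 * z4"
    unfolding c4 using N by (simp add: fact_numeral)
  finally have A: "of_nat (A_sym p N) = fps_nth (log_prod p) N + fps_nth (log_prod p ^ 2) N / 2
      + fps_nth (log_prod p ^ 3) N / 6 + P ^ 4 * z4" .

  have B: "bernoulli (N - 2) = (of_nat N - 2) * div_bernoulli (N - 2)"
    using N by (simp add: div_bernoulli_def of_nat_diff)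
  have UN: "fps_nth ?U N = - div_bernoulli N"
    using N by (simp add: log_coeff1_def)
  have VN: "fps_nth ?V N = 0"
    using N by (simp add: log_coeff2_def bernoulli_odd)
  have WN: "fps_nth ?W N = - (of_nat N - 1) * (of_nat N - 2) * div_bernoulli (N - 2) / 6"
    using N by (simp add: log_coeff3_def B of_nat_diff field_simps)
  define z where "z = z1 + z2 / of_nat 2 + z3 / of_nat 6 + z4"
  have z: "z \<in> ?R" unfolding z_def
    using p z1 z2 z3 z4 by (intro padic_add padic_divide_small) auto
  \<comment> \<open>The coefficient of \<open>-p^3 div_bernoulli (N - 2)\<close> collects
    \<open>(N-1)(N-2)/6\<close> from \<open>L\<close>, \<open>(N-1)/4\<close> from
    \<open>L^2/2\<close> and \<open>1/8\<close> from \<open>L^3/6\<close>. With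
    \<open>N = 2n\<close> the sum is \<open>(16 n^2 - 12 n + 5) / 24\<close>.\<close>
  have "of_nat (A_sym p N) -
     (P ^ 2 / 2 * C_sum N - P * div_bernoulli N - P ^ 3 / 6 * T_sum N
      - (16 * of_nat n ^ 2 - 12 * of_nat n + 5) / 24 * P ^ 3 * div_bernoulli (N - 2)) = P ^ 4 * z"
    using N unfolding A c1 c2 c3 UN VN WN z_def
    by (simp add: log_coeff1_square_nth log_coeff1_cube_nth log_coeff1_log_coeff2_nth B)
       (simp add: N_def field_simps power2_eq_square)
  thus ?thesis using z unfolding padic_cong_def P_def N_def by blast
qed

end
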